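(* Let $R$ be a commutative ring, let $\{N_1,N_2,\ldots,N_k\}$ be a collection of ideals of $R$ satisfying the CNC-condition, and for $i=1,\ldots,k-1$ let $s_i$ be the characteristic of the ideal $N_i$ in the ideal $N_{i+1}$. Let $a\in R$. If $a+N_1$ is a quadratic residue in $R/N_1$, then $a^{s_1s_2\cdots s_{k-1}}$ is a quadratic residue in $R$. More precisely, if $g\in R$ is such that $(g+N_1)^2=a+N_1$ in $R/N_1$, then $$\left(g^{s_1s_2\cdots s_{k-1}}\right)^2=a^{s_1s_2\cdots s_{k-1}}.$$
   Context: An element $a$ of a ring $R$ is a quadratic residue in $R$ if there exists $x\in R$ with $x^2=a$. A collection $\{N_1,\ldots,N_k\}$ of ideals of a ring $R$ satisfies the CNC-condition if the following hold (inclusions are not required to be strict). (1) Chain condition: $\{0\}=N_k\subset N_{k-1}\subset\cdots\subset N_2\subset N_1\subset R$. (2) Nilpotency condition: for $i=1,\ldots,k-1$ there exists an integer $t_i\ge 2$ such that $N_i^{t_i}\subset N_{i+1}$. (3) Characteristic condition: for $i=1,\ldots,k-1$ there exists an integer $s_i\ge 1$ such that $s_iN_i\subset N_{i+1}$, and in addition all prime factors of $s_i$ are greater than or equal to $t_i$. The minimum $t_i$ satisfying the nilpotency condition is called the nilpotency index of $N_i$ in $N_{i+1}$; the minimum $s_i$ satisfying the characteristic condition is called the characteristic of $N_i$ in $N_{i+1}$. *)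

theory Defs
  imports "HOL-Algebra.QuotRing" "HOL-Algebra.Ideal_Product" "HOL-Computational_Algebra.Primes"
begin

definition quadratic_residue :: "('a, 'b) ring_scheme \<Rightarrow> 'a \<Rightarrow> bool" where
  "quadratic_residue R a \<longleftrightarrow>
     a \<in> carrier R \<and> (\<exists>x\<in>carrier R. x [^]\<^bsub>R\<^esub> (2::nat) = a)"

text \<open>The power of the ideal is taken in the multiplicative monoid of ideals, that is,
  with respect to the product of ideals.\<close>

definition nilpotency_condition ::
    "('a, 'b) ring_scheme \<Rightarrow> 'a set \<Rightarrow> 'a set \<Rightarrow> nat \<Rightarrow> bool" where
  "nilpotency_condition R I J t \<longleftrightarrow> t \<ge> 2 \<and> I [^]\<^bsub>ideals_set R\<^esub> t \<subseteq> J"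

definition characteristic_condition ::
    "('a, 'b) ring_scheme \<Rightarrow> 'a set \<Rightarrow> 'a set \<Rightarrow> nat \<Rightarrow> nat \<Rightarrow> bool" where
  "characteristic_condition R I J t s \<longleftrightarrow>
     s \<ge> 1 \<and> (\<lambda>x. add_pow R s x) ` I \<subseteq> J \<and>
     (\<forall>p. Factorial_Ring.prime p \<and> p dvd s \<longrightarrow> p \<ge> t)"

text \<open>The collection is the family \<open>N 1, \<dots>, N k\<close>; other values of \<open>N\<close> are irrelevant.\<close>

definition CNC_condition ::
    "('a, 'b) ring_scheme \<Rightarrow> (nat \<Rightarrow> 'a set) \<Rightarrow> nat \<Rightarrow> bool" where
  "CNC_condition R N k \<longleftrightarrow>
     k \<ge> 1 \<and>
     (\<forall>i\<in>{1..k}. ideal (N i) R) \<and>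
     N k = {\<zero>\<^bsub>R\<^esub>} \<and>
     (\<forall>i\<in>{1..<k}. N (Suc i) \<subseteq> N i) \<and>
     (\<forall>i\<in>{1..<k}. \<exists>t. nilpotency_condition R (N i) (N (Suc i)) t \<and>
        (\<exists>s. characteristic_condition R (N i) (N (Suc i)) t s))"

text \<open>The minimum is over all \<open>s\<close> that satisfy the characteristic condition together with
  some exponent \<open>t\<close> satisfying the nilpotency condition. Fixing any admissible \<open>t\<close>, in
  particular the nilpotency index, gives the same value: see
  \<open>characteristic_in_eq\<close> below.\<close>

definition characteristic_in ::
    "('a, 'b) ring_scheme \<Rightarrow> 'a set \<Rightarrow> 'a set \<Rightarrow> nat" where
  "characteristic_in R I J =
     (LEAST s. \<exists>t. nilpotency_condition R I J t \<and> characteristic_condition R I J t s)"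

lemma (in ring) characteristic_in_eq:
  assumes I: "ideal I R" and J: "ideal J R"
    and t: "nilpotency_condition R I J t" and s: "characteristic_condition R I J t s"
  shows "characteristic_in R I J = (LEAST s'. characteristic_condition R I J t s')"
proof -
  interpret I: ideal I R by (rule I)
  interpret J: ideal J R by (rule J)
  define P where "P m \<longleftrightarrow> m \<ge> 1 \<and> (\<lambda>x. add_pow R m x) ` I \<subseteq> J" for m :: nat
  define e where "e = (LEAST m. P m)"
  have Ps: "P s" using s by (auto simp: P_def characteristic_condition_def)
  have Pe: "P e" unfolding e_def by (rule LeastI[of P, OF Ps])
  have least: "e \<le> m" if "P m" for m unfolding e_def by (rule Least_le[of P, OF that])
  have mod_J: "add_pow R (s mod e) x \<in> J" if x: "x \<in> I" for x
  proof -
    have xR: "x \<in> carrier R" using x by (rule I.Icarr)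
    have "e * (s div e) + s mod e = s" by simp
    then have "add_pow R s x = add_pow R (e * (s div e)) x \<oplus> add_pow R (s mod e) x"
      using xR by (metis add.nat_pow_mult)
    also have "add_pow R (e * (s div e)) x = add_pow R (s div e) (add_pow R e x)"
      using xR by (simp add: add.nat_pow_pow)
    finally have eq: "add_pow R s x = add_pow R (s div e) (add_pow R e x)
        \<oplus> add_pow R (s mod e) x" .
    have eJ: "add_pow R e x \<in> J" using Pe x by (auto simp: P_def)
    have "add_pow R n y \<in> J" if "y \<in> J" for n :: nat and y
      using that by (induction n) (auto simp: J.a_closed)
    then have qJ: "add_pow R (s div e) (add_pow R e x) \<in> J" using eJ by blast
    have sJ: "add_pow R s x \<in> J" using Ps x by (auto simp: P_def)
    have "add_pow R (s mod e) x = \<ominus> (add_pow R (s div e) (add_pow R e x)) \<oplus> add_pow R s x"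
      using eq xR by (simp add: r_neg1)
    then show ?thesis using qJ sJ by (simp add: J.a_closed J.a_inv_closed)
  qed
  have "e dvd s"
  proof (rule ccontr)
    assume "\<not> e dvd s"
    then have "s mod e \<ge> 1" by (simp add: dvd_eq_mod_eq_0 Suc_leI)
    then have "P (s mod e)" using mod_J by (auto simp: P_def)
    then have "e \<le> s mod e" by (rule least)
    moreover have "s mod e < e" using Pe by (simp add: P_def)
    ultimately show False by simp
  qed
  then have e: "characteristic_condition R I J t e"
    using Pe s by (auto simp: characteristic_condition_def P_def intro: dvd_trans)
  have le: "e \<le> m" if "characteristic_condition R I J u m" for u m
    using that by (intro least) (auto simp: P_def characteristic_condition_def)
  have "characteristic_in R I J = e"
    unfolding characteristic_in_def using t e le by (intro Least_equality) blast+
  moreover have "(LEAST s'. characteristic_condition R I J t s') = e"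
    using e le by (intro Least_equality) blast+
  ultimately show ?thesis by simp
qed

end

theory Submission
  imports Defs "HOL-Algebra.Multiplicative_Group"
begin

text \<open>
  If \<open>b\<close> and \<open>c\<close> agree modulo \<open>N i\<close>, then \<open>b\<^sup>s\<close> and \<open>c\<^sup>s\<close> with \<open>s = s i\<close> agree modulo \<open>N (i + 1)\<close>.
  Indeed, expand \<open>(c + d)\<^sup>s\<close> with \<open>d \<in> N i\<close>: the terms with exponent of \<open>d\<close> at least \<open>t i\<close> vanish by
  nilpotency, and for \<open>0 < j < t i\<close> all prime factors of \<open>s\<close> exceed \<open>j\<close>, so that \<open>s\<close> divides
  \<open>s choose j\<close>. Starting from \<open>g\<^sup>2 \<equiv> a\<close> modulo \<open>N 1\<close>, iterating this down the chain
  gives the equality modulo \<open>N k = 0\<close>.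
\<close>

text \<open>Absorption gives \<open>j * (n choose j) = n * ((n - 1) choose (j - 1))\<close>, and the
  factor \<open>j\<close> cancels by coprimality.\<close>

lemma dvd_binomial_if_coprime:
  assumes "coprime n j" "0 < j"
  shows "n dvd (n choose j)"
proof -
  have "n dvd j * (n choose j)"
    using times_binomial_minus1_eq[OF \<open>0 < j\<close>, of n] by simp
  then show ?thesis
    using assms(1) by (simp add: coprime_dvd_mult_right_iff)
qed

text \<open>A common prime factor \<open>p\<close> would satisfy
  \<open>t \<le> p \<le> j < t\<close>.\<close>

lemma coprime_if_prime_factors_ge:
  fixes j s t :: nat
  assumes "\<And>p. Factorial_Ring.prime p \<Longrightarrow> p dvd s \<Longrightarrow> t \<le> p" "0 < j" "j < t"
  shows "coprime s j"
proof (rule ccontr)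
  assume "\<not> coprime s j"
  then obtain p where p: "Factorial_Ring.prime p" "p dvd s" "p dvd j"
    using prime_factor_nat[of "gcd s j"] by (auto simp: coprime_iff_gcd_eq_1)
  then show False
    using assms(1)[of p] dvd_imp_le[of p j] assms(2,3) by simp
qed

lemma (in cring) binomial:
  assumes c: "c \<in> carrier R" and d: "d \<in> carrier R"
  shows "(c \<oplus> d) [^] n =
    (\<Oplus>j\<in>{..n}. add_pow R (n choose j) (c [^] (n - j) \<otimes> d [^] j))"
proof (induction n)
  case 0
  then show ?case by simp
next
  case (Suc n)
  \<comment> \<open>Only the exponent of \<open>c\<close> depends on \<open>m\<close>; the
    coefficient stays at row \<open>n\<close>. So for \<open>j \<le> n\<close>,
    \<open>u (Suc n) j\<close> is \<open>u n j\<close> times \<open>c\<close>, and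
    \<open>v n j\<close> is \<open>u n j\<close> times \<open>d\<close>.\<close>
  define u where "u m j = add_pow R (n choose j) (c [^] (m - j) \<otimes> d [^] j)" for m j :: nat
  define v where "v m j = add_pow R (n choose j) (c [^] (m - j) \<otimes> d [^] Suc j)" for m j :: nat
  have uc [simp]: "u m j \<in> carrier R" for m j using c d by (simp add: u_def)
  have vc [simp]: "v m j \<in> carrier R" for m j using c d by (simp add: v_def)
  have "(c \<oplus> d) [^] Suc n = (\<Oplus>j\<in>{..n}. u n j) \<otimes> d \<oplus> (\<Oplus>j\<in>{..n}. u n j) \<otimes> c"
    using Suc c d by (simp add: u_def r_distr a_comm)
  also have "(\<Oplus>j\<in>{..n}. u n j) \<otimes> d = (\<Oplus>j\<in>{..n}. v n j)"
    using c d by (subst finsum_ldistr)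
      (auto simp: u_def v_def add_pow_ldistr m_assoc intro!: finsum_cong')
  also have "(\<Oplus>j\<in>{..n}. u n j) \<otimes> c = (\<Oplus>j\<in>{..n}. u (Suc n) j)"
  proof (subst finsum_ldistr)
    show "(\<Oplus>j\<in>{..n}. u n j \<otimes> c) = (\<Oplus>j\<in>{..n}. u (Suc n) j)"
    proof (rule finsum_cong')
      fix j assume "j \<in> {..n}"
      then have "c [^] (Suc n - j) = c [^] (n - j) \<otimes> c"
        by (simp add: Suc_diff_le)
      moreover have "x \<otimes> y \<otimes> c = x \<otimes> c \<otimes> y" if "x \<in> carrier R" "y \<in> carrier R" for x y
        using that c by (simp add: m_ac)
      ultimately show "u n j \<otimes> c = u (Suc n) j"
        using c d by (simp add: u_def add_pow_ldistr)
    qed auto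
  qed (use c in auto)
  \<comment> \<open>The added term vanishes because \<open>n choose Suc n\<close> is 0. Splitting
    off index 0 then aligns this sum with that of \<open>v n\<close>.\<close>
  also have "\<dots> = (\<Oplus>j\<in>{..Suc n}. u (Suc n) j)"
    using c d by (subst finsum_Suc) (auto simp: u_def[of _ "Suc n"] binomial_eq_0)
  also have "\<dots> = (\<Oplus>j\<in>{..n}. u (Suc n) (Suc j)) \<oplus> u (Suc n) 0"
    by (rule finsum_Suc2) simp
  also have "(\<Oplus>j\<in>{..n}. v n j) \<oplus> \<dots> =
      (\<Oplus>j\<in>{..n}. v n j \<oplus> u (Suc n) (Suc j)) \<oplus> u (Suc n) 0"
    by (subst finsum_addf) (auto simp: a_assoc)
  \<comment> \<open>Pascal's rule merges the two coefficients.\<close>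
  also have "\<dots> = (\<Oplus>j\<in>{..n}. add_pow R (Suc n choose Suc j)
      (c [^] (Suc n - Suc j) \<otimes> d [^] Suc j)) \<oplus> u (Suc n) 0"
    using c d by (simp add: u_def v_def add.nat_pow_mult)
  also have "\<dots> = (\<Oplus>j\<in>{..Suc n}. add_pow R (Suc n choose j) (c [^] (Suc n - j) \<otimes> d [^] j))"
    using c d by (subst finsum_Suc2) (auto simp: u_def)
  finally show ?case .
qed

lemma (in additive_subgroup) add_pow_nat_closed:
  assumes "abelian_group G" "x \<in> H"
  shows "add_pow G (n::nat) x \<in> H"
proof -
  interpret abelian_group G by fact
  show ?thesis using assms(2) by (induction n) auto
qed

lemma (in additive_subgroup) finsum_closed:
  assumes "abelian_group G" "finite A" "\<And>x. x \<in> A \<Longrightarrow> f x \<in> H"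
  shows "finsum G f A \<in> H"
proof -
  interpret abelian_group G by fact
  show ?thesis
    using assms(2,3)
  proof (induction A rule: finite_induct)
    case (insert x A)
    then have "f \<in> A \<rightarrow> carrier G" "f x \<in> carrier G" using a_subset by auto
    with insert show ?case by simp
  qed simp
qed

text \<open>Transfers the nilpotency condition, stated for iterated ideal products, to powers of a
  single element.\<close>

lemma (in ring) nat_pow_in_ideal_pow:
  assumes "x \<in> I" "x \<in> carrier R"
  shows "x [^] (n::nat) \<in> I [^]\<^bsub>ideals_set R\<^esub> n"
proof (induction n)
  case 0
  then show ?case by (simp add: ideals_set_def)
next
  case (Suc n)
  then show ?case
    using ideal_prod.prod[OF Suc assms(1), of R] by (simp add: ideals_set_def)
qed

text \<open>One step down the chain. The exponent \<open>t\<close> is arbitrary, since the one that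
  accompanies \<open>characteristic_in\<close> is only known to exist.\<close>

lemma (in cring) nat_pow_cong_ideal:
  assumes I: "ideal I R" and J: "ideal J R"
    and nil: "nilpotency_condition R I J t" and char: "characteristic_condition R I J t s"
    and b: "b \<in> carrier R" and c: "c \<in> carrier R" and bc: "b \<ominus> c \<in> I"
  shows "b [^] s \<ominus> c [^] s \<in> J"
proof -
  interpret J: ideal J R by (rule J)
  define d where "d = b \<ominus> c"
  have d: "d \<in> carrier R" "d \<in> I" using b c bc by (auto simp: d_def)
  have b_eq: "b = c \<oplus> d" using b c by (simp add: d_def minus_eq a_lcomm r_neg)
  define f where "f j = add_pow R (s choose j) (c [^] (s - j) \<otimes> d [^] j)" for j
  have f_carrier: "f j \<in> carrier R" for j using c d by (simp add: f_def)
  have f_in_J: "f j \<in> J" if pos: "0 < j" for j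
  proof (cases "t \<le> j")
    case True
    have "d [^] t \<in> J"
      using nat_pow_in_ideal_pow[of d I t] d nil by (auto simp: nilpotency_condition_def)
    then have "d [^] t \<otimes> d [^] (j - t) \<in> J" using d by (simp add: J.I_r_closed)
    then have "d [^] j \<in> J" using True d by (simp add: nat_pow_mult)
    then show ?thesis
      using c by (auto simp: f_def intro!: J.add_pow_nat_closed J.I_l_closed is_abelian_group)
  next
    case False
    then have "coprime s j"
      using char pos
      by (intro coprime_if_prime_factors_ge[of s t]) (auto simp: characteristic_condition_def)
    then obtain q where q: "s choose j = s * q"
      using dvd_binomial_if_coprime[OF _ pos] by (auto elim: dvdE)
    \<comment> \<open>Since \<open>j > 0\<close>, at least one factor \<open>d\<close> lies in
      \<open>I\<close>; then \<open>s\<close> carries the term into \<open>J\<close>, and the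
      multiple by \<open>q\<close> stays there.\<close>
    have "c [^] (s - j) \<otimes> d [^] j \<in> I"
    proof -
      have "d [^] (j - 1) \<otimes> d \<in> I" using d by (intro ideal.I_l_closed[OF I]) auto
      then have "d [^] j \<in> I" using pos by (cases j) auto
      then show ?thesis using c by (intro ideal.I_l_closed[OF I]) auto
    qed
    then have "add_pow R s (c [^] (s - j) \<otimes> d [^] j) \<in> J"
      using char by (auto simp: characteristic_condition_def)
    then have "add_pow R q (add_pow R s (c [^] (s - j) \<otimes> d [^] j)) \<in> J"
      by (rule J.add_pow_nat_closed[OF is_abelian_group])
    then show ?thesis using c d by (simp add: f_def q add.nat_pow_pow)
  qed
  \<comment> \<open>As \<open>s \<ge> 1\<close>, the term \<open>f 0\<close>, which is
    \<open>c [^] s\<close>, can be split off from the positive indices.\<close>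
  obtain m where m: "s = Suc m"
    using char by (cases s) (auto simp: characteristic_condition_def)
  have "b [^] s = (\<Oplus>j\<in>{..Suc m}. f j)"
    using binomial[OF c d(1), of s] by (simp add: b_eq f_def m)
  also have "\<dots> = (\<Oplus>j\<in>{..m}. f (Suc j)) \<oplus> f 0"
    using f_carrier by (intro finsum_Suc2) auto
  also have "f 0 = c [^] s" using c by (simp add: f_def)
  finally have "b [^] s \<ominus> c [^] s = (\<Oplus>j\<in>{..m}. f (Suc j))"
    using c f_carrier by (simp add: minus_eq a_assoc r_neg)
  then show ?thesis
    using f_in_J by (auto intro!: J.finsum_closed is_abelian_group)
qed

text \<open>The least value is attained, possibly with an exponent \<open>u\<close> different from
  \<open>t\<close>.\<close>

lemma characteristic_in_conditions:
  assumes "nilpotency_condition R I J t" "characteristic_condition R I J t s"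
  obtains u where "nilpotency_condition R I J u"
    "characteristic_condition R I J u (characteristic_in R I J)"
  using LeastI_ex[of "\<lambda>s. \<exists>t. nilpotency_condition R I J t \<and> characteristic_condition R I J t s"]
    assms unfolding characteristic_in_def by blast

text \<open>Induction down the chain: for \<open>m = 1\<close> the product is empty and the claim is
  \<open>ba\<close>; each step raises both powers to \<open>s m\<close>, which multiplies the
  exponents.\<close>

lemma (in cring) CNC_pow_cong:
  assumes CNC: "CNC_condition R N k"
    and s: "\<And>i. i \<in> {1..<k} \<Longrightarrow> s i = characteristic_in R (N i) (N (Suc i))"
    and b: "b \<in> carrier R" and a: "a \<in> carrier R" and ba: "b \<ominus> a \<in> N 1"
    and "1 \<le> m" "m \<le> k"
  shows "b [^] (\<Prod>i\<in>{1..<m}. s i) \<ominus> a [^] (\<Prod>i\<in>{1..<m}. s i) \<in> N m"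
  using \<open>1 \<le> m\<close> \<open>m \<le> k\<close>
proof (induction m rule: nat_induct_at_least)
  case base
  then show ?case using a b ba by simp
next
  case (Suc m)
  then have m: "m \<in> {1..<k}" by simp
  then obtain t where t: "nilpotency_condition R (N m) (N (Suc m)) t"
    "characteristic_condition R (N m) (N (Suc m)) t (s m)"
    using CNC s[OF m] unfolding CNC_condition_def
    by (metis characteristic_in_conditions)
  have "ideal (N m) R" "ideal (N (Suc m)) R"
    using CNC Suc by (auto simp: CNC_condition_def)
  from nat_pow_cong_ideal[OF this t _ _ Suc.IH] show ?case
    using Suc a b by (simp add: nat_pow_pow prod.atLeastLessThan_Suc)
qed

theorem theorem3p3:
  fixes R :: "('a, 'b) ring_scheme" (structure)
    and N :: "nat \<Rightarrow> 'a set" and k :: nat and s :: "nat \<Rightarrow> nat" and a :: 'a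
  assumes "cring R"
    and "CNC_condition R N k"
    and "\<And>i. i \<in> {1..<k} \<Longrightarrow> s i = characteristic_in R (N i) (N (Suc i))"
    and "a \<in> carrier R"
  shows "(quadratic_residue (R Quot N 1) (N 1 +> a) \<longrightarrow>
            quadratic_residue R (a [^] (\<Prod>i\<in>{1..<k}. s i))) \<and>
         (\<forall>g\<in>carrier R. (N 1 +> g) [^]\<^bsub>R Quot N 1\<^esub> (2::nat) = N 1 +> a \<longrightarrow>
            (g [^] (\<Prod>i\<in>{1..<k}. s i)) [^] (2::nat) = a [^] (\<Prod>i\<in>{1..<k}. s i))"
proof -
  interpret cring R by fact
  define e where "e = (\<Prod>i\<in>{1..<k}. s i)"
  have k: "1 \<le> k" and N1: "ideal (N 1) R" and Nk: "N k = {\<zero>}"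
    using assms(2) by (auto simp: CNC_condition_def)
  \<comment> \<open>Lets a square root in the quotient be lifted to a representative
    \<open>g\<close> in \<open>R\<close>.\<close>
  have carrier_quot: "carrier (R Quot N 1) = (+>) (N 1) ` carrier R"
    by (auto simp: FactRing_def A_RCOSETS_def')
  have root: "(g [^] e) [^] (2::nat) = a [^] e"
    if g: "g \<in> carrier R" and eq: "(N 1 +> g) [^]\<^bsub>R Quot N 1\<^esub> (2::nat) = N 1 +> a" for g
  proof -
    have "N 1 +> g [^] (2::nat) = N 1 +> a"
      using ring_hom_ring.hom_nat_pow[OF ideal.rcos_ring_hom_ring[OF N1] g, of 2] eq by simp
    then have "g [^] (2::nat) \<ominus> a \<in> N 1"
      using quotient_eq_iff_same_a_r_cos[OF N1] g assms(4) by simp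
    then have "(g [^] (2::nat)) [^] e \<ominus> a [^] e \<in> N k"
      unfolding e_def using CNC_pow_cong[OF assms(2,3)] g assms(4) k by simp
    \<comment> \<open>\<open>N k\<close> is zero, so the congruence is an equality; the exponents 2
      and \<open>e\<close> commute.\<close>
    then show ?thesis
      using g assms(4) Nk by (simp add: nat_pow_pow mult.commute r_right_minus_eq)
  qed
  moreover have "quadratic_residue R (a [^] e)"
    if residue: "quadratic_residue (R Quot N 1) (N 1 +> a)"
  proof -
    obtain g where "g \<in> carrier R" "(N 1 +> g) [^]\<^bsub>R Quot N 1\<^esub> (2::nat) = N 1 +> a"
      using residue
      by (auto simp: quadratic_residue_def carrier_quot simp del: One_nat_def)
    then show ?thesis
      using root assms(4) by (auto simp: quadratic_residue_def)
  qed
  ultimately show ?thesis unfolding e_def by blast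
qed

end
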